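(* For every $n\in\mathbb{N}$, the polynomial $e_n$ of degree $n$ satisfying $e_n'(x)+e_n(x)=x^n$ is a solution of the second-order differential equation of hypergeometric type $$x\,e_n''+(x-n)\,e_n'-n\,e_n=0 .$$
   Context: $\mathbb{N}=\{0,1,2,\dots\}$. A second-order differential equation is of hypergeometric type if it has the form $A(x)y''+B(x)y'+\lambda y=0$ with $A$ a polynomial of degree at most two, $B$ a polynomial of degree at most one and $\lambda$ a constant; a polynomial solution of such an equation is called a hypergeometric polynomial. *)

theory Defs
  imports "HOL-Computational_Algebra.Polynomial"
begin

text \<open>
  Polynomials over an arbitrary field of characteristic 0, in particular over the reals and over
  the complex numbers; \<^const>\<open>pderiv\<close> is the derivative. A polynomial equation is an
  identity in the polynomial ring.
\<close>

text \<open>The equation \<open>A y'' + B y' + l y = 0\<close> is of hypergeometric type; the constant \<open>l\<close> is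
  unrestricted.\<close>

definition hypergeometric_type :: "'a::field_char_0 poly \<Rightarrow> 'a poly \<Rightarrow> 'a \<Rightarrow> bool" where
  "hypergeometric_type A B l \<longleftrightarrow> degree A \<le> 2 \<and> degree B \<le> 1"

definition solves_ode2 ::
    "'a::field_char_0 poly \<Rightarrow> 'a poly \<Rightarrow> 'a \<Rightarrow> 'a poly \<Rightarrow> bool" where
  "solves_ode2 A B l y \<longleftrightarrow> A * pderiv (pderiv y) + B * pderiv y + smult l y = 0"

definition is_exp_poly :: "nat \<Rightarrow> 'a::field_char_0 poly \<Rightarrow> bool" where
  "is_exp_poly n e \<longleftrightarrow> degree e = n \<and> pderiv e + e = monom 1 n"

end

theory Submission imports Defs begin

text \<open>
  Differentiating \<open>e' + e = x^n\<close> and multiplying by \<open>x\<close> gives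
  \<open>x e'' + x e' = n x^n = n (e' + e)\<close>, which is the differential equation.
  Such an \<open>e\<close> exists by the recursion \<open>e_{n+1} = x^{n+1} - (n+1) e_n\<close>.
\<close>

text \<open>Differentiation lowers a positive degree, so \<open>p = - pderiv p\<close> is possible
  only for constants, and then \<open>pderiv p = 0\<close>. This injectivity gives
  uniqueness.\<close>

lemma pderiv_add_self_eq_0_iff:
  fixes p :: "'a::field_char_0 poly"
  shows "pderiv p + p = 0 \<longleftrightarrow> p = 0"
proof
  assume eq: "pderiv p + p = 0"
  then have p: "p = - pderiv p"
    by (simp add: eq_neg_iff_add_eq_0 add.commute)
  then have "degree p = degree p - 1"
    by (metis degree_minus degree_pderiv)
  \<comment> \<open>Subtraction on \<open>nat\<close> is truncated: \<open>d = d - 1\<close> forces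
    \<open>d = 0\<close>.\<close>
  then have "pderiv p = 0"
    by (simp add: pderiv_eq_0_iff)
  with eq show "p = 0" by simp
qed simp

lemma is_exp_poly_Suc:
  fixes e :: "'a::field_char_0 poly"
  assumes "is_exp_poly n e"
  shows "is_exp_poly (Suc n) (monom 1 (Suc n) - smult (of_nat (Suc n)) e)"
proof -
  have deg: "degree e = n" and e: "pderiv e + e = monom 1 n"
    using assms by (auto simp: is_exp_poly_def)
  let ?m = "monom 1 (Suc n) :: 'a poly" and ?c = "of_nat (Suc n) :: 'a"
  \<comment> \<open>The correction term cannot cancel the leading monomial, so the degree is exactly
    \<open>Suc n\<close>.\<close>
  have "degree (smult ?c e) < degree ?m"
    using deg by (simp add: degree_monom_eq del: of_nat_Suc)
  then have "degree (?m - smult ?c e) = Suc n"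
    using degree_add_eq_left[of "- smult ?c e" ?m] by (simp add: degree_monom_eq)
  moreover have "pderiv (?m - smult ?c e) + (?m - smult ?c e)
      = pderiv ?m + ?m - smult ?c (pderiv e + e)"
    by (simp add: pderiv_diff pderiv_smult smult_add_right del: of_nat_Suc)
  \<comment> \<open>The scalar \<open>?c\<close> is chosen so that
    \<open>smult ?c (pderiv e + e)\<close> cancels \<open>pderiv ?m\<close>.\<close>
  then have "pderiv (?m - smult ?c e) + (?m - smult ?c e) = ?m"
    by (simp add: e pderiv_monom smult_monom del: of_nat_Suc)
  ultimately show ?thesis by (simp add: is_exp_poly_def)
qed

lemma ex_is_exp_poly: "\<exists>e :: 'a::field_char_0 poly. is_exp_poly n e"
proof (induction n)
  case 0
  have "is_exp_poly 0 (1 :: 'a poly)" by (simp add: is_exp_poly_def)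
  then show ?case ..
next
  case (Suc n)
  then show ?case using is_exp_poly_Suc by blast
qed

lemma is_exp_poly_unique:
  fixes e f :: "'a::field_char_0 poly"
  assumes "is_exp_poly n e" "is_exp_poly n f"
  shows "e = f"
proof -
  have "pderiv (e - f) + (e - f) = (pderiv e + e) - (pderiv f + f)"
    by (simp add: pderiv_diff)
  also have "\<dots> = 0"
    using assms by (simp add: is_exp_poly_def)
  finally show ?thesis
    by (simp only: pderiv_add_self_eq_0_iff right_minus_eq)
qed

lemma is_exp_poly_solves_ode2:
  fixes e :: "'a::field_char_0 poly"
  assumes "is_exp_poly n e"
  shows "solves_ode2 [:0, 1:] [:- of_nat n, 1:] (- of_nat n) e"
proof -
  have e: "pderiv e + e = monom 1 n"
    using assms by (simp add: is_exp_poly_def)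
  \<comment> \<open>\<open>pCons 0\<close> is multiplication by \<open>x\<close>.\<close>
  have "pCons 0 (pderiv (pderiv e) + pderiv e) = pCons 0 (pderiv (pderiv e + e))"
    by (simp add: pderiv_add)
  also have "\<dots> = smult (of_nat n) (monom 1 n)"
    \<comment> \<open>For \<open>n = 0\<close> both sides vanish; otherwise the factor
      \<open>x\<close> restores the exponent lowered by the derivative.\<close>
    by (cases n) (simp_all add: e pderiv_monom smult_monom del: of_nat_Suc flip: monom_Suc)
  also have "\<dots> = smult (of_nat n) (pderiv e) + smult (of_nat n) e"
    by (simp add: smult_add_right flip: e)
  finally have "pCons 0 (pderiv (pderiv e)) + pCons 0 (pderiv e)
      = smult (of_nat n) (pderiv e) + smult (of_nat n) e"
    by simp
  then show ?thesis
    by (simp add: solves_ode2_def algebra_simps)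
qed

theorem mainTheorem4:
  fixes n :: nat
  shows "(\<exists>!e :: 'a::field_char_0 poly. is_exp_poly n e) \<and>
         hypergeometric_type [:0, 1:] [:- of_nat n, 1:] (- of_nat n :: 'a) \<and>
         (\<forall>e :: 'a poly. is_exp_poly n e \<longrightarrow>
            solves_ode2 [:0, 1:] [:- of_nat n, 1:] (- of_nat n) e)"
proof (intro conjI allI impI)
  show "\<exists>!e :: 'a poly. is_exp_poly n e"
    using ex_is_exp_poly is_exp_poly_unique by blast
  show "hypergeometric_type [:0, 1:] [:- of_nat n, 1:] (- of_nat n :: 'a)"
    by (simp add: hypergeometric_type_def)
qed (rule is_exp_poly_solves_ode2)

end
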